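(* There are infinitely many $n$ such that every nondeterministic OBDD on $n$ variables computing $\mathtt{NotO_n}$ has width at least $\lfloor\log n\rfloor-1$.
   Context: $\log$ denotes the logarithm base $2$. For $\nu\in\{0,1\}^n$ let $\#_0(\nu)$, $\#_1(\nu)$ be the numbers of zeros and ones in $\nu$. $\mathtt{NotO_n}(\nu)=0$ if $\#_0(\nu)=\#_1(\nu)$ and $1$ otherwise. A nondeterministic OBDD on variables $x_1,\dots,x_n$ with order $\pi$ (a permutation of $\{1,\dots,n\}$) is a leveled directed acyclic graph with levels $0,\dots,n$, a single source node at level $0$, where each node at level $j-1$ has any number of outgoing edges labelled $0$ or $1$ to nodes at level $j$, and nodes at level $n$ are accepting or rejecting. A computation path on $\nu$ starts at the source and at step $j$ follows an edge labelled $\nu_{\pi(j)}$; $\nu$ is accepted iff some computation path ends at an accepting node. The width is the maximum number of nodes in a level. *)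

theory Defs
  imports Complex_Main "HOL-Library.FuncSet" "HOL-Library.Disjoint_Sets"
    "HOL-Combinatorics.Permutations"
begin

text \<open>Bits are booleans, with \<open>False\<close> for 0 and \<open>True\<close> for 1; the variables are indexed by
  \<open>{1..n}\<close>.\<close>

definition cube :: "nat \<Rightarrow> (nat \<Rightarrow> bool) set" where
  "cube n = {1..n} \<rightarrow>\<^sub>E UNIV"

definition num_zeros :: "nat \<Rightarrow> (nat \<Rightarrow> bool) \<Rightarrow> nat" where
  "num_zeros n \<nu> = card {i \<in> {1..n}. \<not> \<nu> i}"

definition num_ones :: "nat \<Rightarrow> (nat \<Rightarrow> bool) \<Rightarrow> nat" where
  "num_ones n \<nu> = card {i \<in> {1..n}. \<nu> i}"

definition NotO :: "nat \<Rightarrow> (nat \<Rightarrow> bool) \<Rightarrow> bool" where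
  "NotO n \<nu> = (if num_zeros n \<nu> = num_ones n \<nu> then False else True)"

record 'v nobdd =
  level :: "nat \<Rightarrow> 'v set"
  source :: 'v
  edges :: "('v \<times> bool \<times> 'v) set"
  accepting :: "'v set"

text \<open>Nodes without incoming edges are allowed at positive levels. The nodes of level \<open>n\<close> outside
  \<open>accepting B\<close> are the rejecting ones.\<close>

definition is_nobdd :: "nat \<Rightarrow> 'v nobdd \<Rightarrow> bool" where
  "is_nobdd n B \<longleftrightarrow>
     (\<forall>j\<in>{0..n}. finite (level B j)) \<and>
     disjoint_family_on (level B) {0..n} \<and>
     level B 0 = {source B} \<and>
     edges B \<subseteq> (\<Union>j\<in>{1..n}. level B (j - 1) \<times> UNIV \<times> level B j) \<and>
     accepting B \<subseteq> level B n"

definition computation_path ::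
    "nat \<Rightarrow> (nat \<Rightarrow> nat) \<Rightarrow> 'v nobdd \<Rightarrow> (nat \<Rightarrow> bool) \<Rightarrow> (nat \<Rightarrow> 'v) \<Rightarrow> bool" where
  "computation_path n \<pi> B \<nu> p \<longleftrightarrow>
     p 0 = source B \<and> (\<forall>j\<in>{1..n}. (p (j - 1), \<nu> (\<pi> j), p j) \<in> edges B)"

definition accepts :: "nat \<Rightarrow> (nat \<Rightarrow> nat) \<Rightarrow> 'v nobdd \<Rightarrow> (nat \<Rightarrow> bool) \<Rightarrow> bool" where
  "accepts n \<pi> B \<nu> \<longleftrightarrow> (\<exists>p. computation_path n \<pi> B \<nu> p \<and> p n \<in> accepting B)"

definition computes :: "nat \<Rightarrow> (nat \<Rightarrow> nat) \<Rightarrow> 'v nobdd \<Rightarrow> ((nat \<Rightarrow> bool) \<Rightarrow> bool) \<Rightarrow> bool" where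
  "computes n \<pi> B f \<longleftrightarrow> (\<forall>\<nu>\<in>cube n. accepts n \<pi> B \<nu> \<longleftrightarrow> f \<nu>)"

definition width :: "nat \<Rightarrow> 'v nobdd \<Rightarrow> nat" where
  "width n B = Max ((\<lambda>j. card (level B j)) ` {0..n})"

end

theory Submission imports Defs
begin

text \<open>For \<open>n = 2 m\<close> consider the inputs whose first \<open>m\<close> read bits contain \<open>k\<close> ones and whose last \<open>m\<close>
  read bits contain \<open>l\<close> ones. Such an input is rejected exactly if \<open>k + l = m\<close>, so for \<open>k \<noteq> k'\<close> the
  suffix with \<open>m - k\<close> ones separates the prefixes with \<open>k\<close> and \<open>k'\<close> ones. Hence the sets of nodes of
  level \<open>m\<close> reachable by the \<open>m + 1\<close> prefixes are pairwise distinct, which gives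
  \<open>m + 1 \<le> 2 ^ width\<close>.\<close>

definition reachable :: "(nat \<Rightarrow> nat) \<Rightarrow> 'v nobdd \<Rightarrow> nat \<Rightarrow> (nat \<Rightarrow> bool) \<Rightarrow> 'v set" where
  "reachable \<pi> B m \<nu> = {p m | p. computation_path m \<pi> B \<nu> p}"

lemma reachable_cong:
  assumes "\<And>j. j \<in> {1..m} \<Longrightarrow> \<nu> (\<pi> j) = \<nu>' (\<pi> j)"
  shows "reachable \<pi> B m \<nu> = reachable \<pi> B m \<nu>'"
proof -
  have "computation_path m \<pi> B \<nu> = computation_path m \<pi> B \<nu>'"
    unfolding computation_path_def by (intro ext conj_cong ball_cong) (simp_all add: assms)
  then show ?thesis by (simp add: reachable_def)
qed

text \<open>Edges join consecutive levels only, and since the levels are disjoint, the level of its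
  tail determines an edge's place. Induction along the path then fixes the level of every
  node.\<close>

lemma computation_path_in_level:
  assumes B: "is_nobdd n B" and p: "computation_path m \<pi> B \<nu> p" and "m \<le> n" "j \<le> m"
  shows "p j \<in> level B j"
  using \<open>j \<le> m\<close>
proof (induction j)
  case 0
  show ?case using B p by (simp add: is_nobdd_def computation_path_def)
next
  case (Suc j)
  have "(p j, \<nu> (\<pi> (Suc j)), p (Suc j)) \<in> edges B"
    using p Suc.prems unfolding computation_path_def
    by (metis Suc_eq_plus1 atLeastAtMost_iff diff_Suc_1 le_add2)
  moreover have "edges B \<subseteq> (\<Union>i\<in>{1..n}. level B (i - 1) \<times> UNIV \<times> level B i)"
    using B by (simp add: is_nobdd_def)
  ultimately obtain i where i: "i \<in> {1..n}" "p j \<in> level B (i - 1)" "p (Suc j) \<in> level B i"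
    by blast
  have "disjoint_family_on (level B) {0..n}"
    using B by (simp add: is_nobdd_def)
  moreover have "p j \<in> level B j" using Suc by simp
  moreover have "i - 1 \<in> {0..n}" "j \<in> {0..n}" using i Suc.prems \<open>m \<le> n\<close> by auto
  ultimately have "i - 1 = j"
    using i(2) by (metis disjoint_family_onD disjoint_iff)
  \<comment> \<open>Subtraction is truncated here, so \<open>i \<ge> 1\<close> is what excludes
    \<open>i = 0\<close> when \<open>j = 0\<close>.\<close>
  then have "i = Suc j" using i(1) by auto
  then show ?case using i by simp
qed

lemma reachable_subset_level:
  assumes "is_nobdd n B" "m \<le> n"
  shows "reachable \<pi> B m \<nu> \<subseteq> level B m"
  using computation_path_in_level[OF assms(1) _ assms(2)] by (auto simp: reachable_def)

text \<open>Cut and paste at level \<open>m\<close>: an accepting path for \<open>\<nu>\<close>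
  crosses that level at a node which \<open>\<nu>'\<close> can also reach, and from there on both
  inputs feed the same bits.\<close>

lemma accepts_if_reachable_subset:
  assumes acc: "accepts n \<pi> B \<nu>" and "m \<le> n"
    and sub: "reachable \<pi> B m \<nu> \<subseteq> reachable \<pi> B m \<nu>'"
    and suffix: "\<And>j. j \<in> {m<..n} \<Longrightarrow> \<nu> (\<pi> j) = \<nu>' (\<pi> j)"
  shows "accepts n \<pi> B \<nu>'"
proof -
  obtain p where p: "computation_path n \<pi> B \<nu> p" "p n \<in> accepting B"
    using acc by (auto simp: accepts_def)
  have "computation_path m \<pi> B \<nu> p"
    using p(1) \<open>m \<le> n\<close> by (simp add: computation_path_def)
  then have "p m \<in> reachable \<pi> B m \<nu>'"
    using sub by (auto simp: reachable_def)
  then obtain q where q: "computation_path m \<pi> B \<nu>' q" "q m = p m"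
    by (auto simp: reachable_def)
  define r where "r j = (if j \<le> m then q j else p j)" for j
  have "(r (j - 1), \<nu>' (\<pi> j), r j) \<in> edges B" if "j \<in> {1..n}" for j
  proof (cases "j \<le> m")
    case True
    then show ?thesis using q that by (auto simp: r_def computation_path_def)
  next
    case False
    \<comment> \<open>At the seam \<open>j = m + 1\<close> the predecessor still comes from
      \<open>q\<close>; there \<open>q m = p m\<close> glues the two halves.\<close>
    then have "r (j - 1) = p (j - 1)"
      using q(2) by (cases "j - 1 = m") (auto simp: r_def)
    moreover have "(p (j - 1), \<nu> (\<pi> j), p j) \<in> edges B"
      using p(1) that unfolding computation_path_def by blast
    ultimately show ?thesis
      using False suffix[of j] that by (simp add: r_def)
  qed
  moreover have "r 0 = source B" using q(1) by (simp add: r_def computation_path_def)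
  moreover have "r n = p n" using q(2) \<open>m \<le> n\<close> by (auto simp: r_def)
  ultimately show ?thesis
    using p(2) by (auto simp: accepts_def computation_path_def)
qed

text \<open>The blocks are laid out in reading order, so \<open>inv \<pi>\<close> turns a variable
  index into the step at which it is read. The restricted lambda makes the input extensional, as
  \<open>cube\<close> demands.\<close>

definition two_block_input :: "(nat \<Rightarrow> nat) \<Rightarrow> nat \<Rightarrow> nat \<Rightarrow> nat \<Rightarrow> nat \<Rightarrow> bool" where
  "two_block_input \<pi> m k l = (\<lambda>i\<in>{1..2 * m}. inv \<pi> i \<in> {1..k} \<union> {m<..m + l})"

lemma two_block_input_in_cube: "two_block_input \<pi> m k l \<in> cube (2 * m)"
  by (simp add: two_block_input_def cube_def)

lemma two_block_input_perm:
  assumes "\<pi> permutes {1..2 * m}" "j \<in> {1..2 * m}"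
  shows "two_block_input \<pi> m k l (\<pi> j) \<longleftrightarrow> j \<in> {1..k} \<union> {m<..m + l}"
  using assms permutes_in_image[OF assms(1), of j] permutes_inverses(2)[OF assms(1), of j]
  by (simp add: two_block_input_def)

lemma num_zeros_plus_num_ones: "num_zeros n \<nu> + num_ones n \<nu> = n"
proof -
  have "card ({i \<in> {1..n}. \<not> \<nu> i} \<union> {i \<in> {1..n}. \<nu> i}) = num_zeros n \<nu> + num_ones n \<nu>"
    unfolding num_zeros_def num_ones_def by (rule card_Un_disjoint) auto
  moreover have "{i \<in> {1..n}. \<not> \<nu> i} \<union> {i \<in> {1..n}. \<nu> i} = {1..n}" by auto
  ultimately show ?thesis by simp
qed

text \<open>As \<open>\<pi>\<close> permutes the indices, ones can be counted by reading step. The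
  bound on \<open>k\<close> keeps the two blocks disjoint, the bound on \<open>l\<close> keeps the
  second one inside \<open>{1..2 * m}\<close>.\<close>

lemma num_ones_two_block_input:
  assumes \<pi>: "\<pi> permutes {1..2 * m}" and "k \<le> m" "l \<le> m"
  shows "num_ones (2 * m) (two_block_input \<pi> m k l) = k + l"
proof -
  have "{i \<in> {1..2 * m}. two_block_input \<pi> m k l i}
      = \<pi> ` {j \<in> {1..2 * m}. two_block_input \<pi> m k l (\<pi> j)}"
    by (subst (1) permutes_image[OF \<pi>, symmetric]) auto
  also have "{j \<in> {1..2 * m}. two_block_input \<pi> m k l (\<pi> j)} = {1..k} \<union> {m<..m + l}"
    using two_block_input_perm[OF \<pi>] assms(2,3) by auto
  finally have "num_ones (2 * m) (two_block_input \<pi> m k l) = card ({1..k} \<union> {m<..m + l})"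
    using card_image[OF inj_on_subset[OF permutes_inj[OF \<pi>] subset_UNIV]]
    by (simp add: num_ones_def)
  also have "\<dots> = k + l"
    using assms(2) by (subst card_Un_disjoint) auto
  finally show ?thesis .
qed

lemma NotO_two_block_input:
  assumes "\<pi> permutes {1..2 * m}" "k \<le> m" "l \<le> m"
  shows "NotO (2 * m) (two_block_input \<pi> m k l) \<longleftrightarrow> k + l \<noteq> m"
  using num_ones_two_block_input[OF assms]
    num_zeros_plus_num_ones[of "2 * m" "two_block_input \<pi> m k l"]
  by (auto simp: NotO_def)

lemma NotO_two_power_width:
  assumes \<pi>: "\<pi> permutes {1..2 * m}" and B: "is_nobdd (2 * m) B"
    and comp: "computes (2 * m) \<pi> B (NotO (2 * m))"
  shows "m + 1 \<le> 2 ^ width (2 * m) B"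
proof -
  let ?x = "two_block_input \<pi> m"
  let ?R = "\<lambda>k. reachable \<pi> B m (?x k 0)"
  have acc: "accepts (2 * m) \<pi> B (?x k l) \<longleftrightarrow> k + l \<noteq> m" if "k \<le> m" "l \<le> m" for k l
    using comp two_block_input_in_cube NotO_two_block_input[OF \<pi> that]
    by (auto simp: computes_def)
  \<comment> \<open>The parameter \<open>l\<close> affects only bits read after step
    \<open>m\<close>, so \<open>l = 0\<close> can represent every suffix.\<close>
  have R: "reachable \<pi> B m (?x k l) = ?R k" for k l
    by (rule reachable_cong) (use two_block_input_perm[OF \<pi>] in auto)
  have "inj_on ?R {0..m}"
  proof (rule inj_onI, rule ccontr)
    fix k k' assume *: "k \<in> {0..m}" "k' \<in> {0..m}" "?R k = ?R k'" "k \<noteq> k'"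
    \<comment> \<open>The suffix with \<open>m - k\<close> ones balances the prefix \<open>k\<close>
      but not \<open>k'\<close>; equal reachable sets would carry acceptance over to the balanced
      input.\<close>
    have "accepts (2 * m) \<pi> B (?x k' (m - k))"
      by (subst acc) (use * in auto)
    then have "accepts (2 * m) \<pi> B (?x k (m - k))"
    proof (rule accepts_if_reachable_subset[where m = m])
      show "reachable \<pi> B m (?x k' (m - k)) \<subseteq> reachable \<pi> B m (?x k (m - k))"
        using *(3) R[of k "m - k"] R[of k' "m - k"] by simp
      show "?x k' (m - k) (\<pi> j) = ?x k (m - k) (\<pi> j)" if "j \<in> {m<..2 * m}" for j
        using that * two_block_input_perm[OF \<pi>, of j] by auto
    qed simp
    then show False using acc[of k "m - k"] * by auto
  qed
  moreover have "?R ` {0..m} \<subseteq> Pow (level B m)"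
    using reachable_subset_level[OF B, of m] by auto
  moreover have fin: "finite (level B m)" using B by (simp add: is_nobdd_def)
  ultimately have "card {0..m} \<le> card (Pow (level B m))"
    by (intro card_inj_on_le) auto
  then have "m + 1 \<le> 2 ^ card (level B m)" using fin by (simp add: card_Pow)
  also have "\<dots> \<le> 2 ^ width (2 * m) B"
    unfolding width_def by (intro power_increasing Max_ge) auto
  finally show ?thesis .
qed

theorem theorem6:
  "infinite {n :: nat. n \<ge> 1 \<and>
     (\<forall>(\<pi> :: nat \<Rightarrow> nat) (B :: 'v nobdd).
        \<pi> permutes {1..n} \<and> is_nobdd n B \<and> computes n \<pi> B (NotO n) \<longrightarrow>
        int (width n B) \<ge> \<lfloor>log 2 (real n)\<rfloor> - 1)}" (is "infinite ?S")
proof -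
  \<comment> \<open>All positive even numbers serve as witnesses; \<open>Suc\<close> keeps
    \<open>n \<ge> 1\<close>.\<close>
  have "2 * Suc k \<in> ?S" for k
  proof -
    have "\<lfloor>log 2 (real (2 * Suc k))\<rfloor> - 1 \<le> int (width (2 * Suc k) B)"
      if "\<pi> permutes {1..2 * Suc k}" "is_nobdd (2 * Suc k) B"
        "computes (2 * Suc k) \<pi> B (NotO (2 * Suc k))" for \<pi> and B :: "'v nobdd"
    proof -
      let ?w = "width (2 * Suc k) B"
      \<comment> \<open>Doubling the bound for \<open>m = Suc k\<close> to reach
        \<open>n = 2 * m\<close> costs one factor 2, hence the \<open>- 1\<close> after taking
        logarithms.\<close>
      have "2 * Suc k \<le> 2 ^ (?w + 1)"
        using NotO_two_power_width[OF that] by simp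
      then have "real (2 * Suc k) \<le> 2 ^ (?w + 1)"
        by (metis of_nat_le_iff of_nat_numeral of_nat_power)
      then have "log 2 (real (2 * Suc k)) \<le> ?w + 1"
        by (simp add: log_le_iff powr_realpow del: of_nat_mult of_nat_Suc mult_Suc_right)
      then show ?thesis by linarith
    qed
    then show ?thesis by (intro CollectI conjI allI impI) auto
  qed
  then have "range (\<lambda>k. 2 * Suc k) \<subseteq> ?S" by blast
  moreover have "infinite (range (\<lambda>k. 2 * Suc k))"
    by (simp add: finite_image_iff inj_on_def)
  ultimately show ?thesis by (rule infinite_super)
qed

end
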